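(* Consider a Markov decision process (MDP) with a reachability objective, with finite state space $S$, target state $s^*\in S$, finite nonempty action sets $A(s)$ and transition probabilities $p(\cdot\mid s,a)$. Suppose that for every initial state there is a strategy that weakly overtakes all other strategies at that initial state. Then there exists a stationary strategy that is strongly overtaking optimal at each initial state.
   Context: An MDP with a reachability objective is given by a finite set $S$ of states with a target state $s^*\in S$, for each $s\in S$ a nonempty finite set $A(s)$ of actions, and for each $s\in S$, $a\in A(s)$ a probability distribution $p(\cdot\mid s,a)$ on $S$. Play runs over periods $1,2,3,\ldots$: it starts at period 1 in an initial state $s_1\in S\setminus\{s^*\}$ (initial states are always elements of $S\setminus\{s^*\}$); at each period $t$ the decision maker chooses an action $a_t\in A(s_t)$ and $s_{t+1}$ is drawn from $p(\cdot\mid s_t,a_t)$. A history at period $t$ is a sequence $(s_1,a_1,\ldots,s_{t-1},a_{t-1},s_t)$ with $a_i\in A(s_i)$ and $p(s_{i+1}\mid s_i,a_i)>0$ for all $i<t$; its final state is $s_t$. A strategy $\sigma$ assigns to each history $h$ a probability distribution $\sigma(h)$ on $A(s)$, where $s$ is the final state of $h$. It is stationary if $\sigma(h)$ depends only on the final state of $h$. $\mathbb{P}_{s\sigma}$ denotes the probability measure on infinite histories induced by initial state $s$ and strategy $\sigma$. Let $t^*$ be the first period at which the state is $s^*$ ($t^*=\infty$ if $s^*$ is never reached). A strategy $\sigma$ weakly overtakes a strategy $\sigma'$ at the initial state $s$ if there is $T\in\mathbb{N}$ such that $\mathbb{P}_{s\sigma}(t^*\leq t)\geq\mathbb{P}_{s\sigma'}(t^*\leq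 t)$ for all $t\geq T$, with strict inequality for infinitely many $t$. A strategy is strongly overtaking optimal at the initial state $s$ if no strategy weakly overtakes it at $s$. *)

theory Defs
  imports "HOL-Probability.Probability" "HOL-Library.Extended_Nat"
begin

text \<open>
  The state space is the whole (finite) type of states. The distributions \<open>trans M s a\<close> with
  \<open>a \<notin> act M s\<close> are irrelevant: no history and no play uses them.
\<close>

record ('s, 'a) mdp =
  act :: "'s \<Rightarrow> 'a set"
  trans :: "'s \<Rightarrow> 'a \<Rightarrow> 's pmf"
  target :: 's

definition is_mdp :: "('s::finite, 'a::finite) mdp \<Rightarrow> bool" where
  "is_mdp M \<longleftrightarrow> (\<forall>s. act M s \<noteq> {})"

text \<open>
  The sequence \<open>(s\<^sub>1, a\<^sub>1, \<dots>, s\<^sub>t\<^sub>-\<^sub>1, a\<^sub>t\<^sub>-\<^sub>1, s\<^sub>t)\<close> is encoded as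
  \<open>([(s\<^sub>1, a\<^sub>1), \<dots>, (s\<^sub>t\<^sub>-\<^sub>1, a\<^sub>t\<^sub>-\<^sub>1)], s\<^sub>t)\<close>.
\<close>

type_synonym ('s, 'a) hist = "('s \<times> 'a) list \<times> 's"

definition hist_states :: "('s, 'a) hist \<Rightarrow> 's list" where
  "hist_states h = map fst (fst h) @ [snd h]"

abbreviation final_state :: "('s, 'a) hist \<Rightarrow> 's" where
  "final_state h \<equiv> snd h"

definition is_history :: "('s::finite, 'a::finite) mdp \<Rightarrow> ('s, 'a) hist \<Rightarrow> bool" where
  "is_history M h \<longleftrightarrow>
     hist_states h ! 0 \<noteq> target M \<and>
     (\<forall>i < length (fst h).
        snd (fst h ! i) \<in> act M (hist_states h ! i) \<and>
        pmf (trans M (hist_states h ! i) (snd (fst h ! i))) (hist_states h ! Suc i) > 0)"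

type_synonym ('s, 'a) strategy = "('s, 'a) hist \<Rightarrow> 'a pmf"

definition is_strategy :: "('s::finite, 'a::finite) mdp \<Rightarrow> ('s, 'a) strategy \<Rightarrow> bool" where
  "is_strategy M \<sigma> \<longleftrightarrow> (\<forall>h. is_history M h \<longrightarrow> set_pmf (\<sigma> h) \<subseteq> act M (final_state h))"

definition stationary :: "('s::finite, 'a::finite) mdp \<Rightarrow> ('s, 'a) strategy \<Rightarrow> bool" where
  "stationary M \<sigma> \<longleftrightarrow>
     (\<forall>h h'. is_history M h \<and> is_history M h' \<and> final_state h = final_state h' \<longrightarrow> \<sigma> h = \<sigma> h')"

text \<open>
  Infinite histories are functions \<open>\<omega> :: nat \<Rightarrow> 's \<times> 'a\<close>. Periods start at 1 and indices at 0,
  so \<open>\<omega> i\<close> is the state-action pair of period \<open>i + 1\<close>. The kernel below is the conditional law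
  of \<open>\<omega> i\<close> given \<open>\<omega> 0, \<dots>, \<omega> (i - 1)\<close>; the measure on infinite histories is then the one given
  by the Ionescu-Tulcea theorem.
\<close>

definition next_state :: "('s::finite, 'a::finite) mdp \<Rightarrow> 's \<Rightarrow> nat \<Rightarrow> (nat \<Rightarrow> 's \<times> 'a) \<Rightarrow> 's pmf" where
  "next_state M s i \<omega> =
     (case i of 0 \<Rightarrow> return_pmf s | Suc j \<Rightarrow> trans M (fst (\<omega> j)) (snd (\<omega> j)))"

definition play_kernel ::
  "('s::finite, 'a::finite) mdp \<Rightarrow> 's \<Rightarrow> ('s, 'a) strategy \<Rightarrow> nat \<Rightarrow> (nat \<Rightarrow> 's \<times> 'a) \<Rightarrow> ('s \<times> 'a) measure"
where
  "play_kernel M s \<sigma> i \<omega> = measure_pmf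
     (bind_pmf (next_state M s i \<omega>) (\<lambda>s'. map_pmf (Pair s') (\<sigma> (map \<omega> [0..<i], s'))))"

lemma Ionescu_Tulcea_play_kernel:
  "Ionescu_Tulcea (play_kernel M s \<sigma>) (\<lambda>_. count_space UNIV)"
proof (rule Ionescu_Tulcea.intro)
  fix i :: nat
  have "PiM {0..<i} (\<lambda>_. count_space (UNIV :: ('a \<times> 'b) set)) =
      count_space (PiE {0..<i} (\<lambda>_. UNIV))"
    by (intro count_space_PiM_finite) (auto intro: countable_finite)
  then show "play_kernel M s \<sigma> i \<in>
      PiM {0..<i} (\<lambda>_. count_space UNIV) \<rightarrow>\<^sub>M subprob_algebra (count_space UNIV)"
    by (auto simp: play_kernel_def space_subprob_algebra intro: measure_pmf.subprob_space_axioms)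
next
  fix i :: nat and x :: "nat \<Rightarrow> 'a \<times> 'b"
  show "prob_space (play_kernel M s \<sigma> i x)"
    unfolding play_kernel_def by (rule measure_pmf.prob_space_axioms)
qed

definition play_measure ::
  "('s::finite, 'a::finite) mdp \<Rightarrow> 's \<Rightarrow> ('s, 'a) strategy \<Rightarrow> (nat \<Rightarrow> 's \<times> 'a) measure" where
  "play_measure M s \<sigma> = projective_family.lim UNIV
     (Ionescu_Tulcea.CI (play_kernel M s \<sigma>) (\<lambda>_. count_space UNIV)) (\<lambda>_. count_space UNIV)"

lemma distr_play_measure:
  assumes "finite J"
  shows "distr (play_measure M s \<sigma>) (PiM J (\<lambda>_. count_space UNIV)) (\<lambda>\<omega>. restrict \<omega> J) =
    Ionescu_Tulcea.CI (play_kernel M s \<sigma>) (\<lambda>_. count_space UNIV) J"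
  using Ionescu_Tulcea.distr_lim[OF Ionescu_Tulcea_play_kernel assms]
  unfolding play_measure_def .

definition hitting_time :: "('s::finite, 'a::finite) mdp \<Rightarrow> (nat \<Rightarrow> 's \<times> 'a) \<Rightarrow> enat" where
  "hitting_time M \<omega> = (INF i \<in> {i. fst (\<omega> i) = target M}. enat (Suc i))"

definition reach_prob ::
  "('s::finite, 'a::finite) mdp \<Rightarrow> 's \<Rightarrow> ('s, 'a) strategy \<Rightarrow> nat \<Rightarrow> real" where
  "reach_prob M s \<sigma> t =
     measure (play_measure M s \<sigma>) {\<omega> \<in> space (play_measure M s \<sigma>). hitting_time M \<omega> \<le> enat t}"

definition weakly_overtakes ::
  "('s::finite, 'a::finite) mdp \<Rightarrow> 's \<Rightarrow> ('s, 'a) strategy \<Rightarrow> ('s, 'a) strategy \<Rightarrow> bool" where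
  "weakly_overtakes M s \<sigma> \<sigma>' \<longleftrightarrow>
     (\<exists>T. (\<forall>t\<ge>T. reach_prob M s \<sigma> t \<ge> reach_prob M s \<sigma>' t) \<and>
          infinite {t. reach_prob M s \<sigma> t > reach_prob M s \<sigma>' t})"

definition strongly_overtaking_optimal ::
  "('s::finite, 'a::finite) mdp \<Rightarrow> 's \<Rightarrow> ('s, 'a) strategy \<Rightarrow> bool" where
  "strongly_overtaking_optimal M s \<sigma> \<longleftrightarrow>
     \<not> (\<exists>\<sigma>'. is_strategy M \<sigma>' \<and> weakly_overtakes M s \<sigma>' \<sigma>)"

text \<open>
  When a strategy is compared with all other strategies at an initial state \<open>s\<close>, a strategy under
  which the hitting time has the same law from \<open>s\<close> does not count as an other one. Comparing
  strategies as functions on histories instead would make the existence of a strategy that weakly overtakes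
  all others equivalent to there being only one strategy, because changing a strategy at histories
  that have probability zero from \<open>s\<close> gives a different function that is never weakly overtaken.
\<close>

definition same_hitting_law ::
  "('s::finite, 'a::finite) mdp \<Rightarrow> 's \<Rightarrow> ('s, 'a) strategy \<Rightarrow> ('s, 'a) strategy \<Rightarrow> bool" where
  "same_hitting_law M s \<sigma> \<sigma>' \<longleftrightarrow> (\<forall>t. reach_prob M s \<sigma> t = reach_prob M s \<sigma>' t)"

end

theory Submission
  imports Defs
begin

text \<open>
  The dominating strategies have hitting laws that are eventually at least those of all other
  strategies, and a law that is eventually at least a dominating one coincides with it. This turns
  the eventual comparison into an exact one-step recursion: at each state some action followed by
  dominating continuations reproduces the dominating law for every horizon. Playing these actions
  satisfies the same recursion, so one stationary strategy has the dominating law from every state.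
\<close>

section \<open>Finite-horizon hitting probabilities\<close>

text \<open>Here \<open>hs\<close> is the past before the current state \<open>s\<close>, and
  \<open>n\<close> counts the transitions still allowed, so \<open>n = 0\<close> inspects
  \<open>s\<close> alone. The recursion stops at the target since only the first visit
  matters.\<close>

fun hit_within ::
  "('s::finite, 'a::finite) mdp \<Rightarrow> ('s, 'a) strategy \<Rightarrow> ('s \<times> 'a) list \<Rightarrow> 's \<Rightarrow> nat \<Rightarrow> real"
where
  "hit_within M \<sigma> hs s 0 = of_bool (s = target M)"
| "hit_within M \<sigma> hs s (Suc n) =
     (if s = target M then 1
      else \<Sum>a\<in>UNIV. pmf (\<sigma> (hs, s)) a *
             (\<Sum>s'\<in>UNIV. pmf (trans M s a) s' * hit_within M \<sigma> (hs @ [(s, a)]) s' n))"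

lemma hit_within_target [simp]: "hit_within M \<sigma> hs (target M) n = 1"
  by (cases n) auto

lemma expectation_pmf_finite:
  fixes p :: "'b::finite pmf" and f :: "'b \<Rightarrow> real"
  shows "measure_pmf.expectation p f = (\<Sum>x\<in>UNIV. pmf p x * f x)"
  by (subst integral_measure_pmf[of UNIV]) auto

lemma expectation_play_kernel:
  fixes M :: "('s::finite, 'a::finite) mdp" and f :: "'s \<times> 'a \<Rightarrow> real"
  shows "integral\<^sup>L (play_kernel M s \<sigma> i \<omega>) f =
    (\<Sum>s'\<in>UNIV. pmf (next_state M s i \<omega>) s' *
       (\<Sum>a\<in>UNIV. pmf (\<sigma> (map \<omega> [0..<i], s')) a * f (s', a)))"
  unfolding play_kernel_def
  by (subst pmf_expectation_bind[of UNIV])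
    (auto simp flip: expectation_pmf_finite)

lemma sum_pmf_UNIV: "(\<Sum>x\<in>UNIV. pmf (p :: 'b::finite pmf) x) = 1"
  by (simp add: sum_pmf_eq_1)

section \<open>Agreement of the recursion with the play measure\<close>

text \<open>Points of the product over \<open>{0..<n}\<close> are \<open>undefined\<close> off this
  index set, hence the restriction to \<open>extensional\<close>.\<close>

definition hit_event :: "('s::finite, 'a::finite) mdp \<Rightarrow> nat \<Rightarrow> (nat \<Rightarrow> 's \<times> 'a) set" where
  "hit_event M n = {\<omega> \<in> extensional {0..<n}. \<exists>j<n. fst (\<omega> j) = target M}"

lemma sets_PiM_play:
  fixes n :: nat
  shows "sets (PiM {0..<n} (\<lambda>_. count_space (UNIV :: ('s::finite \<times> 'a::finite) set))) =
     Pow (extensional {0..<n})"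
proof -
  have "PiM {0..<n} (\<lambda>_. count_space (UNIV :: ('s \<times> 'a) set)) =
      count_space (PiE {0..<n} (\<lambda>_. UNIV))"
    by (intro count_space_PiM_finite) auto
  then show ?thesis
    by (simp add: PiE_def)
qed

lemma space_PiM_play:
  fixes n :: nat
  shows "space (PiM {0..<n} (\<lambda>_. count_space (UNIV :: ('s::finite \<times> 'a::finite) set))) =
     extensional {0..<n}"
  by (simp add: space_PiM PiE_def)

text \<open>With the first \<open>i\<close> coordinates fixed, \<open>n\<close> more are drawn. The
  first of these reveals the next state without any further transition, so \<open>n = Suc k\<close>
  coordinates leave \<open>k\<close> transitions to \<open>hit_within\<close>.\<close>

lemma measure_C_hit_event:
  fixes M :: "('s::finite, 'a::finite) mdp"
  assumes "\<omega> \<in> extensional {0..<i}"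
  shows "measure (Ionescu_Tulcea.C (play_kernel M s \<sigma>) (\<lambda>_. count_space UNIV) i n \<omega>)
           (hit_event M (i + n)) =
    (if \<exists>j<i. fst (\<omega> j) = target M then 1
     else case n of 0 \<Rightarrow> 0
       | Suc k \<Rightarrow> \<Sum>s'\<in>UNIV. pmf (next_state M s i \<omega>) s' * hit_within M \<sigma> (map \<omega> [0..<i]) s' k)"
  using assms
proof (induction n arbitrary: i \<omega>)
  case 0
  interpret IT: Ionescu_Tulcea "play_kernel M s \<sigma>" "\<lambda>_. count_space UNIV"
    by (rule Ionescu_Tulcea_play_kernel)
  have "hit_event M i \<subseteq> extensional {0..<i}"
    by (auto simp: hit_event_def)
  then show ?case
    using 0 by (simp add: measure_return sets_PiM_play hit_event_def indicator_def)
next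
  case (Suc n)
  interpret IT: Ionescu_Tulcea "play_kernel M s \<sigma>" "\<lambda>_. count_space UNIV"
    by (rule Ionescu_Tulcea_play_kernel)
  let ?N = "\<lambda>n. PiM {0..<n} (\<lambda>_. count_space (UNIV :: ('s \<times> 'a) set))"
  have \<omega>: "\<omega> \<in> space (?N i)"
    using Suc.prems by (simp add: space_PiM_play)
  interpret eP: prob_space "IT.eP i \<omega>"
    by (rule IT.prob_space_eP[OF \<omega>])
  have E: "hit_event M (i + Suc n) \<in> sets (?N (Suc i + n))"
    by (auto simp: sets_PiM_play hit_event_def)
  \<comment> \<open>\<open>IT.C\<close> appends kernels at the end while \<open>hit_within\<close>
    unrolls from the front, so the first kernel is split off.\<close>
  have C1: "IT.C i (Suc n) \<omega> = IT.eP i \<omega> \<bind> IT.C (Suc i) n"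
    using IT.split_C[OF \<omega>, of 1 n] by (simp add: bind_return[OF IT.measurable_eP \<omega>])
  have meas: "IT.C (Suc i) n \<in> measurable (IT.eP i \<omega>) (subprob_algebra (?N (Suc i + n)))"
    using IT.measurable_C[of "Suc i" n] by (simp add: measurable_cong_sets[OF IT.sets_eP[OF \<omega>] refl])
  have upd: "fun_upd \<omega> i y \<in> extensional {0..<Suc i}" for y
    using Suc.prems by (auto simp: extensional_def)
  have "measure (IT.C i (Suc n) \<omega>) (hit_event M (i + Suc n)) =
      (\<integral>x. measure (IT.C (Suc i) n x) (hit_event M (i + Suc n)) \<partial>IT.eP i \<omega>)"
    unfolding C1 by (rule eP.measure_bind[OF meas E])
  also have "\<dots> = (\<integral>y. measure (IT.C (Suc i) n (fun_upd \<omega> i y)) (hit_event M (i + Suc n))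
                     \<partial>play_kernel M s \<sigma> i \<omega>)"
    unfolding IT.eP_def
  proof (rule integral_distr)
    show "fun_upd \<omega> i \<in> play_kernel M s \<sigma> i \<omega> \<rightarrow>\<^sub>M ?N (Suc i)"
      using upd by (auto simp: measurable_def sets_PiM_play space_PiM_play play_kernel_def)
    show "(\<lambda>x. measure (IT.C (Suc i) n x) (hit_event M (i + Suc n))) \<in> borel_measurable (?N (Suc i))"
      by (auto simp: measurable_def sets_PiM_play space_PiM_play)
  qed
  also have "\<dots> = (\<Sum>s'\<in>UNIV. pmf (next_state M s i \<omega>) s' *
       (\<Sum>a\<in>UNIV. pmf (\<sigma> (map \<omega> [0..<i], s')) a *
          measure (IT.C (Suc i) n (fun_upd \<omega> i (s', a))) (hit_event M (Suc i + n))))"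
    by (subst expectation_play_kernel) simp
  finally have eq: "measure (IT.C i (Suc n) \<omega>) (hit_event M (i + Suc n)) = \<dots>" .
  show ?case
  proof (cases "\<exists>j<i. fst (\<omega> j) = target M")
    case True
    then have "\<exists>j<Suc i. fst (fun_upd \<omega> i y j) = target M" for y
      by (metis fun_upd_other less_Suc_eq less_irrefl)
    then show ?thesis
      unfolding eq Suc.IH[OF upd] using True by (simp add: sum_pmf_UNIV)
  next
    case False
    have map: "map (fun_upd \<omega> i y) [0..<Suc i] = map \<omega> [0..<i] @ [y]" for y
      by simp
    have hit: "(\<exists>j<Suc i. fst (fun_upd \<omega> i (s', a) j) = target M) \<longleftrightarrow> s' = target M" for s' a
      using False by (auto simp: less_Suc_eq)
    have "(\<Sum>a\<in>UNIV. pmf (\<sigma> (map \<omega> [0..<i], s')) a *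
          measure (IT.C (Suc i) n (fun_upd \<omega> i (s', a))) (hit_event M (Suc i + n))) =
        hit_within M \<sigma> (map \<omega> [0..<i]) s' n" for s'
      unfolding Suc.IH[OF upd] hit map
      by (cases n) (auto simp: next_state_def sum_pmf_UNIV)
    then show ?thesis
      unfolding eq if_not_P[OF False] by simp
  qed
qed

text \<open>Index \<open>j\<close> is period \<open>j + 1\<close>, hence the strict bound. A
  nonempty set in \<open>enat\<close> attains its infimum.\<close>

lemma hitting_time_le_iff: "hitting_time M \<omega> \<le> enat t \<longleftrightarrow> (\<exists>j<t. fst (\<omega> j) = target M)"
proof (cases "{i. fst (\<omega> i) = target M} = {}")
  case True
  then show ?thesis
    by (auto simp: hitting_time_def top_enat_def)
next
  case False
  let ?A = "(\<lambda>i. enat (Suc i)) ` {i. fst (\<omega> i) = target M}"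
  from False have "?A \<noteq> {}" by auto
  then have "Inf ?A \<in> ?A"
    by (metis wellorder_InfI ex_in_conv)
  then obtain i where i: "fst (\<omega> i) = target M" "Inf ?A = enat (Suc i)"
    by auto
  moreover have "Inf ?A \<le> enat (Suc j)" if "fst (\<omega> j) = target M" for j
    using that by (intro INF_lower) simp
  ultimately show ?thesis
    unfolding hitting_time_def by (metis Suc_le_eq dual_order.trans enat_ord_simps(1))
qed

lemma reach_prob_0: "reach_prob M s \<sigma> 0 = 0"
  by (simp add: reach_prob_def hitting_time_le_iff)

text \<open>The event depends only on the first \<open>n + 1\<close> coordinates, so it can be
  measured in their finite-dimensional law; period \<open>n + 1\<close> comes after \<open>n\<close>
  transitions.\<close>

lemma reach_prob_Suc: "reach_prob M s \<sigma> (Suc n) = hit_within M \<sigma> [] s n"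
proof -
  interpret IT: Ionescu_Tulcea "play_kernel M s \<sigma>" "\<lambda>_. count_space UNIV"
    by (rule Ionescu_Tulcea_play_kernel)
  let ?t = "Suc n"
  let ?N = "PiM {0..<?t} (\<lambda>_. count_space (UNIV :: ('a \<times> 'b) set))"
  have sets: "sets (play_measure M s \<sigma>) = sets (PiM UNIV (\<lambda>_. count_space UNIV))"
    unfolding play_measure_def by (rule IT.PF.sets_lim)
  have E: "hit_event M ?t \<in> sets ?N"
    by (auto simp: sets_PiM_play hit_event_def)
  have meas: "(\<lambda>\<omega>. restrict \<omega> {0..<?t}) \<in> measurable (play_measure M s \<sigma>) ?N"
    unfolding measurable_cong_sets[OF sets refl] by (rule measurable_restrict_subset) simp
  have "reach_prob M s \<sigma> ?t = measure (play_measure M s \<sigma>)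
      ((\<lambda>\<omega>. restrict \<omega> {0..<?t}) -` hit_event M ?t \<inter> space (play_measure M s \<sigma>))"
    unfolding reach_prob_def hitting_time_le_iff
    by (rule arg_cong[where f = "measure _"]) (auto simp: hit_event_def)
  also have "\<dots> = measure (IT.CI {0..<?t}) (hit_event M ?t)"
    using distr_play_measure[of "{0..<?t}" M s \<sigma>] by (simp flip: measure_distr[OF meas E])
  also have "\<dots> = measure (IT.C 0 ?t (\<lambda>_. undefined)) (hit_event M (0 + ?t))"
  proof -
    have "IT.PF.emb {0..<?t} {0..<?t} (hit_event M ?t) = hit_event M ?t"
      by (rule prod_emb_id) (auto simp: hit_event_def PiE_def)
    then show ?thesis
      using IT.emeasure_CI[OF subset_refl E] by (simp add: measure_def)
  qed
  also have "\<dots> = hit_within M \<sigma> [] s n"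
    by (subst measure_C_hit_event) (auto simp: next_state_def indicator_def
        if_distrib[of "\<lambda>x. x * _"] cong: if_cong)
  finally show ?thesis .
qed


section \<open>Concatenation of strategies\<close>

lemma is_history_Nil [simp]: "is_history M ([], s) \<longleftrightarrow> s \<noteq> target M"
  by (simp add: is_history_def hist_states_def)

lemma length_hist_states: "length (hist_states h) = Suc (length (fst h))"
  by (simp add: hist_states_def)

lemma hist_states_snoc: "hist_states (hs @ [(s, a)], x) = hist_states (hs, s) @ [x]"
  by (simp add: hist_states_def)

lemma hist_states_snoc_nth_0: "hist_states (hs @ [(s, a)], x) ! 0 = hist_states (hs, s) ! 0"
  by (simp add: hist_states_snoc nth_append length_hist_states)

lemma hist_states_nth_length: "hist_states (hs, s) ! length hs = s"
  by (simp add: hist_states_def nth_append)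

lemma is_history_snoc:
  "is_history M (hs @ [(s, a)], x) \<longleftrightarrow>
     is_history M (hs, s) \<and> a \<in> act M s \<and> x \<in> set_pmf (trans M s a)"
proof -
  let ?h = "(hs @ [(s, a)], x)"
  have nth: "hist_states ?h ! i = hist_states (hs, s) ! i" if "i \<le> length hs" for i
    using that by (simp add: hist_states_snoc nth_append length_hist_states)
  have last: "hist_states ?h ! Suc (length hs) = x"
    by (simp add: hist_states_def nth_append)
  have "snd (fst ?h ! i) = snd (hs ! i)" if "i < length hs" for i
    using that by (simp add: nth_append)
  then show ?thesis
    unfolding is_history_def
    by (simp add: All_less_Suc nth last hist_states_nth_length pmf_positive_iff conj_ac)
qed

text \<open>
  Strategies are constrained only at histories, so the comparison is restricted to positions \<open>P\<close>
  that the play can reach.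
\<close>

lemma hit_within_transfer:
  assumes "P hs x"
    and step: "\<And>hs x a x'. \<lbrakk>P hs x; x \<noteq> target M; a \<in> set_pmf (\<sigma> (pre @ hs, x));
                  x' \<in> set_pmf (trans M x a)\<rbrakk> \<Longrightarrow> P (hs @ [(x, a)]) x'"
    and eq: "\<And>hs x. P hs x \<Longrightarrow> \<tau> (pre' @ hs, x) = \<sigma> (pre @ hs, x)"
  shows "hit_within M \<tau> (pre' @ hs) x n = hit_within M \<sigma> (pre @ hs) x n"
  using assms(1)
proof (induction n arbitrary: hs x)
  case (Suc n)
  show ?case
  proof (cases "x = target M")
    case False
    have "pmf (\<sigma> (pre @ hs, x)) a *
        (\<Sum>x'\<in>UNIV. pmf (trans M x a) x' * hit_within M \<tau> (pre' @ hs @ [(x, a)]) x' n) =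
        pmf (\<sigma> (pre @ hs, x)) a *
        (\<Sum>x'\<in>UNIV. pmf (trans M x a) x' * hit_within M \<sigma> (pre @ hs @ [(x, a)]) x' n)" for a
    proof (cases "a \<in> set_pmf (\<sigma> (pre @ hs, x))")
      case True
      have "pmf (trans M x a) x' * hit_within M \<tau> (pre' @ hs @ [(x, a)]) x' n =
          pmf (trans M x a) x' * hit_within M \<sigma> (pre @ hs @ [(x, a)]) x' n" for x'
        using Suc.IH[OF step[OF Suc.prems False True, of x']]
        by (cases "x' \<in> set_pmf (trans M x a)") (auto simp: set_pmf_iff)
      then show ?thesis by (simp only:)
    qed (simp add: set_pmf_iff)
    then show ?thesis
      by (simp only: hit_within.simps False if_False eq[OF Suc.prems] append_assoc)
  qed simp
qed simp

definition default_action :: "('s::finite, 'a::finite) mdp \<Rightarrow> 's \<Rightarrow> 'a pmf" where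
  "default_action M s = return_pmf (SOME a. a \<in> act M s)"

lemma set_default_action: "is_mdp M \<Longrightarrow> set_pmf (default_action M s) \<subseteq> act M s"
  by (auto simp: default_action_def is_mdp_def some_in_eq)

text \<open>A history \<open>h\<close> may fail to extend \<open>(s, a)\<close> to a history, and
  there \<open>\<sigma>\<close> is unconstrained; the default action keeps the result a
  strategy.\<close>

definition continuation ::
  "('s::finite, 'a::finite) mdp \<Rightarrow> ('s, 'a) strategy \<Rightarrow> 's \<Rightarrow> 'a \<Rightarrow> ('s, 'a) strategy"
where
  "continuation M \<sigma> s a h =
     (if is_history M ((s, a) # fst h, snd h) then \<sigma> ((s, a) # fst h, snd h)
      else default_action M (snd h))"

lemma is_strategy_continuation:
  assumes "is_mdp M" "is_strategy M \<sigma>"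
  shows "is_strategy M (continuation M \<sigma> s a)"
  using assms(2) set_default_action[OF assms(1)]
  by (fastforce simp: is_strategy_def continuation_def)

lemma hit_within_continuation:
  assumes "is_strategy M \<sigma>" "s \<noteq> target M" "a \<in> act M s" "s' \<in> set_pmf (trans M s a)"
  shows "hit_within M (continuation M \<sigma> s a) [] s' n = hit_within M \<sigma> [(s, a)] s' n"
proof -
  have "hit_within M (continuation M \<sigma> s a) ([] @ []) s' n = hit_within M \<sigma> ([(s, a)] @ []) s' n"
  proof (rule hit_within_transfer[where P = "\<lambda>hs x. is_history M ((s, a) # hs, x)"])
    show "is_history M ([(s, a)], s')"
      using assms is_history_snoc[of M "[]" s a s'] by simp
    show "is_history M ((s, a) # hs @ [(x, b)], x')"
      if "is_history M ((s, a) # hs, x)" "b \<in> set_pmf (\<sigma> ([(s, a)] @ hs, x))"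
        "x' \<in> set_pmf (trans M x b)" for hs x b x'
      using that assms(1) is_history_snoc[of M "(s, a) # hs" x b x']
      by (fastforce simp: is_strategy_def)
  qed (simp add: continuation_def)
  then show ?thesis by simp
qed

text \<open>After the first move, the first pair is dropped and the state of period 2 selects which
  \<open>S\<close> is followed from then on. The default action also covers tails that start at the
  target, where \<open>S\<close> need not be a strategy.\<close>

definition play_then ::
  "('s::finite, 'a::finite) mdp \<Rightarrow> 's \<Rightarrow> 'a pmf \<Rightarrow> ('s \<Rightarrow> ('s, 'a) strategy) \<Rightarrow> ('s, 'a) strategy"
where
  "play_then M s d S h =
     (case fst h of
        [] \<Rightarrow> if snd h = s then d else default_action M (snd h)
      | _ # hs \<Rightarrow>
          if is_history M (hs, snd h) then S (hist_states (hs, snd h) ! 0) (hs, snd h)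
          else default_action M (snd h))"

lemma is_strategy_play_then:
  assumes "is_mdp M" "set_pmf d \<subseteq> act M s" "\<And>s. s \<noteq> target M \<Longrightarrow> is_strategy M (S s)"
  shows "is_strategy M (play_then M s d S)"
  unfolding is_strategy_def
proof (intro allI impI)
  fix h :: "('a, 'b) hist"
  show "set_pmf (play_then M s d S h) \<subseteq> act M (snd h)"
  proof (cases "fst h")
    case Nil
    then show ?thesis
      using assms set_default_action[OF assms(1)] by (auto simp: play_then_def)
  next
    case (Cons y hs)
    \<comment> \<open>The tail is a history, so its first state is not the target and the hypothesis
      on \<open>S\<close> applies.\<close>
    have "set_pmf (S (hist_states (hs, snd h) ! 0) (hs, snd h)) \<subseteq> act M (snd h)"
      if "is_history M (hs, snd h)"
      using assms(3)[of "hist_states (hs, snd h) ! 0"] that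
      by (fastforce simp: is_strategy_def is_history_def)
    then show ?thesis
      using Cons set_default_action[OF assms(1), of "snd h"] by (simp add: play_then_def)
  qed
qed

lemma hit_within_play_then:
  assumes "s' \<noteq> target M" "is_strategy M (S s')"
  shows "hit_within M (play_then M s d S) [(s, a)] s' n = hit_within M (S s') [] s' n"
proof -
  have "hit_within M (play_then M s d S) ([(s, a)] @ []) s' n = hit_within M (S s') ([] @ []) s' n"
  \<comment> \<open>The invariant also records the first state of the tail, because it determines
    the strategy in force.\<close>
  proof (rule hit_within_transfer
      [where P = "\<lambda>hs x. is_history M (hs, x) \<and> hist_states (hs, x) ! 0 = s'"])
    show "is_history M ([], s') \<and> hist_states ([], s') ! 0 = s'"
      using assms(1) by (simp add: hist_states_def)
    show "is_history M (hs @ [(x, b)], x') \<and> hist_states (hs @ [(x, b)], x') ! 0 = s'"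
      if "is_history M (hs, x) \<and> hist_states (hs, x) ! 0 = s'" "b \<in> set_pmf (S s' ([] @ hs, x))"
        "x' \<in> set_pmf (trans M x b)" for hs x b x'
      using that assms(2)
      by (fastforce simp: is_strategy_def is_history_snoc hist_states_snoc_nth_0)
  qed (auto simp: play_then_def)
  then show ?thesis by simp
qed

lemma hit_within_play_then_Suc:
  assumes "s \<noteq> target M" "\<And>s. s \<noteq> target M \<Longrightarrow> is_strategy M (S s)"
  shows "hit_within M (play_then M s d S) [] s (Suc n) =
    (\<Sum>a\<in>UNIV. pmf d a * (\<Sum>s'\<in>UNIV. pmf (trans M s a) s' * hit_within M (S s') [] s' n))"
proof -
  have "hit_within M (play_then M s d S) [(s, a)] s' n = hit_within M (S s') [] s' n" for a s'
    using hit_within_play_then[OF _ assms(2)] by (cases "s' = target M") auto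
  then show ?thesis
    using assms(1) by (simp add: play_then_def)
qed

section \<open>Dominating hitting laws\<close>

text \<open>The deficits \<open>c - f x\<close> are nonnegative on the support and their average is
  at most 0, so each vanishes there. This lets a randomized first move be replaced by any single
  action it uses.\<close>

lemma pmf_average_attained:
  fixes f :: "'b::finite \<Rightarrow> real"
  assumes "(\<Sum>x\<in>UNIV. pmf p x * f x) \<ge> c" "\<And>x. x \<in> set_pmf p \<Longrightarrow> f x \<le> c" "a \<in> set_pmf p"
  shows "f a = c"
proof -
  have nonneg: "pmf p x * (c - f x) \<ge> 0" for x
    using assms(2)[of x] by (cases "x \<in> set_pmf p") (auto simp: set_pmf_iff)
  have "(\<Sum>x\<in>UNIV. pmf p x * (c - f x)) = c - (\<Sum>x\<in>UNIV. pmf p x * f x)"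
    by (simp add: right_diff_distrib sum_subtractf sum_pmf_UNIV flip: sum_distrib_right)
  with assms(1) have "(\<Sum>x\<in>UNIV. pmf p x * (c - f x)) = 0"
    using sum_nonneg[of UNIV "\<lambda>x. pmf p x * (c - f x)"] nonneg by force
  then have "pmf p a * (c - f a) = 0"
    using nonneg by (subst (asm) sum_nonneg_eq_0_iff) auto
  then show ?thesis
    using assms(3) by (simp add: set_pmf_iff)
qed

text \<open>The shift between periods and transitions does not affect an eventual
  comparison.\<close>

lemma eventually_reach_prob_iff:
  "(\<exists>T. \<forall>t\<ge>T. reach_prob M s \<sigma>' t \<le> reach_prob M s \<sigma> t) \<longleftrightarrow>
    (\<forall>\<^sub>F n in sequentially. hit_within M \<sigma>' [] s n \<le> hit_within M \<sigma> [] s n)"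
  unfolding eventually_sequentially[symmetric]
  by (subst eventually_sequentially_Suc[symmetric]) (simp add: reach_prob_Suc)

lemma same_hitting_law_iff:
  "same_hitting_law M s \<sigma> \<sigma>' \<longleftrightarrow> (\<forall>n. hit_within M \<sigma> [] s n = hit_within M \<sigma>' [] s n)"
  by (metis same_hitting_law_def reach_prob_Suc reach_prob_0 not0_implies_Suc)

text \<open>\<open>S s\<close> is the dominating strategy for the initial state \<open>s\<close>
  only; these strategies may differ from state to state and are to be merged into one.\<close>

locale dominated_mdp =
  fixes M :: "('s::finite, 'a::finite) mdp" and S :: "'s \<Rightarrow> ('s, 'a) strategy"
  assumes mdp: "is_mdp M"
    and strategy: "s \<noteq> target M \<Longrightarrow> is_strategy M (S s)"
    and dominates: "\<lbrakk>s \<noteq> target M; is_strategy M \<tau>; \<not> same_hitting_law M s (S s) \<tau>\<rbrakk>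
                      \<Longrightarrow> weakly_overtakes M s (S s) \<tau>"
begin

text \<open>At the target this is constantly 1 whatever \<open>S\<close> is there, so one-step
  averages can run over all states.\<close>

definition law :: "'s \<Rightarrow> nat \<Rightarrow> real" where
  "law s n = hit_within M (S s) [] s n"

text \<open>Law of hitting when \<open>a\<close> is played first and the dominating strategies
  follow. \<open>n\<close> excludes the first transition, so the counterpart is
  \<open>law s (Suc n)\<close>.\<close>

definition action_law :: "'s \<Rightarrow> 'a \<Rightarrow> nat \<Rightarrow> real" where
  "action_law s a n = (\<Sum>s'\<in>UNIV. pmf (trans M s a) s' * law s' n)"

lemma eventually_le_law:
  assumes "is_strategy M \<tau>"
  shows "\<forall>\<^sub>F n in sequentially. hit_within M \<tau> [] s n \<le> law s n"
proof (cases "s = target M \<or> same_hitting_law M s (S s) \<tau>")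
  case True
  then show ?thesis
    by (auto simp: law_def same_hitting_law_iff)
next
  case False
  then show ?thesis
    using dominates[of s \<tau>] assms unfolding law_def eventually_reach_prob_iff[symmetric]
    by (auto simp: weakly_overtakes_def)
qed

text \<open>If the laws differed, \<open>S s\<close> would weakly overtake \<open>\<tau>\<close> and
  be strictly ahead infinitely often, against \<open>ge\<close>. An eventual inequality thus becomes
  an identity at every horizon.\<close>

lemma eq_law:
  assumes "s \<noteq> target M" "is_strategy M \<tau>"
    and ge: "\<forall>\<^sub>F n in sequentially. law s n \<le> hit_within M \<tau> [] s n"
  shows "hit_within M \<tau> [] s n = law s n"
proof (rule ccontr)
  assume "hit_within M \<tau> [] s n \<noteq> law s n"
  then have "\<not> same_hitting_law M s (S s) \<tau>"
    unfolding same_hitting_law_iff law_def by metis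
  then have inf: "infinite {t. reach_prob M s (S s) t > reach_prob M s \<tau> t}"
    using dominates assms by (auto simp: weakly_overtakes_def)
  obtain T where "\<forall>t\<ge>T. reach_prob M s (S s) t \<le> reach_prob M s \<tau> t"
    using ge unfolding law_def eventually_reach_prob_iff[symmetric] by blast
  then have "{t. reach_prob M s (S s) t > reach_prob M s \<tau> t} \<subseteq> {..<T}"
    by (auto simp: not_le[symmetric])
  with inf show False
    using finite_subset by blast
qed

lemma hit_within_play_then_law:
  "s \<noteq> target M \<Longrightarrow> hit_within M (play_then M s d S) [] s (Suc n) =
     (\<Sum>a\<in>UNIV. pmf d a * action_law s a n)"
  unfolding action_law_def law_def by (rule hit_within_play_then_Suc[OF _ strategy])

lemma play_then_strategy:
  "set_pmf d \<subseteq> act M s \<Longrightarrow> is_strategy M (play_then M s d S)"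
  by (rule is_strategy_play_then[OF mdp _ strategy])

text \<open>Playing \<open>a\<close> and then the dominating strategies is itself a strategy, hence
  eventually bounded by \<open>law s\<close>.\<close>

lemma eventually_action_law_le:
  assumes "s \<noteq> target M" "a \<in> act M s"
  shows "\<forall>\<^sub>F n in sequentially. action_law s a n \<le> law s (Suc n)"
proof -
  have "is_strategy M (play_then M s (return_pmf a) S)"
    using assms by (intro play_then_strategy) simp
  from eventually_le_law[OF this, of s]
  have "\<forall>\<^sub>F n in sequentially. hit_within M (play_then M s (return_pmf a) S) [] s (Suc n) \<le> law s (Suc n)"
    by (subst (asm) eventually_sequentially_Suc[symmetric])
  then show ?thesis
    by (simp add: hit_within_play_then_law[OF assms(1)] indicator_def if_distrib[of "\<lambda>x. x * _"]
        del: hit_within.simps cong: if_cong)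
qed

text \<open>
  Replacing every continuation of \<open>S s\<close> by the dominating strategy of its initial state loses
  nothing in the long run. By domination no first action can gain either, so every first action
  that \<open>S s\<close> uses with positive probability reproduces the dominating law.
\<close>

lemma ex_conserving_action:
  assumes s: "s \<noteq> target M"
  shows "\<exists>a\<in>act M s. \<forall>n. law s (Suc n) = action_law s a n"
proof -
  define d where "d = S s ([], s)"
  have d: "set_pmf d \<subseteq> act M s"
    using strategy[OF s] s unfolding is_strategy_def d_def by (metis is_history_Nil snd_conv)
  obtain a where a: "a \<in> set_pmf d"
    using set_pmf_not_empty[of d] by blast
  \<comment> \<open>What \<open>S s\<close> does after \<open>(s, b)\<close> is a strategy from
    \<open>s'\<close>, to which the domination at \<open>s'\<close> applies.\<close>
  have "\<forall>\<^sub>F n in sequentially. hit_within M (S s) [(s, b)] s' n \<le> law s' n"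
    if "b \<in> set_pmf d" "s' \<in> set_pmf (trans M s b)" for b s'
    using eventually_le_law[OF is_strategy_continuation[OF mdp strategy[OF s], of s b], of s']
      hit_within_continuation[OF strategy[OF s] s _ that(2)] d that(1)
    by (auto simp: subset_iff)
  \<comment> \<open>There are finitely many pairs of action and successor, so one threshold serves
    all of them.\<close>
  then have "\<forall>\<^sub>F n in sequentially. \<forall>b\<in>set_pmf d. \<forall>s'\<in>set_pmf (trans M s b).
      hit_within M (S s) [(s, b)] s' n \<le> law s' n"
    by (simp add: eventually_ball_finite_distrib)
  then have average_ge: "\<forall>\<^sub>F n in sequentially. law s (Suc n) \<le> (\<Sum>b\<in>UNIV. pmf d b * action_law s b n)"
  proof eventually_elim
    case (elim n)
    have "pmf d b * (\<Sum>s'\<in>UNIV. pmf (trans M s b) s' * hit_within M (S s) [(s, b)] s' n)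
        \<le> pmf d b * action_law s b n" for b
    proof (cases "b \<in> set_pmf d")
      case True
      have "pmf (trans M s b) s' * hit_within M (S s) [(s, b)] s' n \<le> pmf (trans M s b) s' * law s' n" for s'
        using elim True by (cases "s' \<in> set_pmf (trans M s b)") (auto simp: set_pmf_iff mult_left_mono)
      then show ?thesis
        unfolding action_law_def by (rule mult_left_mono[OF sum_mono]) simp
    qed (simp add: set_pmf_iff)
    then show ?case
      using s by (simp add: law_def d_def sum_mono)
  qed
  have "\<forall>\<^sub>F n in sequentially. \<forall>b\<in>set_pmf d. action_law s b n \<le> law s (Suc n)"
    using eventually_action_law_le[OF s] d by (auto simp: eventually_ball_finite_distrib)
  \<comment> \<open>For each large \<open>n\<close>, the average of the action laws is at least
    \<open>law s (Suc n)\<close> while none of them exceeds it.\<close>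
  with average_ge have ev: "\<forall>\<^sub>F n in sequentially. action_law s a n = law s (Suc n)"
    by eventually_elim (rule pmf_average_attained[OF _ _ a], auto)
  \<comment> \<open>So far equality holds only for large \<open>n\<close>. Realizing
    \<open>action_law s a\<close> as the law of an actual strategy lets \<open>eq_law\<close> extend
    it to all \<open>n\<close>.\<close>
  let ?\<tau> = "play_then M s (return_pmf a) S"
  have \<tau>: "hit_within M ?\<tau> [] s (Suc n) = action_law s a n" for n
    by (simp add: hit_within_play_then_law[OF s] indicator_def if_distrib[of "\<lambda>x. x * _"]
        del: hit_within.simps cong: if_cong)
  have "\<forall>\<^sub>F n in sequentially. law s (Suc n) \<le> hit_within M ?\<tau> [] s (Suc n)"
    unfolding \<tau> using ev by eventually_elim simp
  then have "\<forall>\<^sub>F n in sequentially. law s n \<le> hit_within M ?\<tau> [] s n"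
    by (subst eventually_sequentially_Suc[symmetric])
  then have "hit_within M ?\<tau> [] s (Suc n) = law s (Suc n)" for n
    using a d by (intro eq_law[OF s] play_then_strategy) auto
  with \<tau> a d show ?thesis
    by (metis subsetD)
qed

section \<open>The optimal stationary strategy\<close>

text \<open>The conserving action at a state serves all horizons at once, so always playing it
  satisfies the recursion of \<open>law\<close> with the same initial values, and induction on the
  horizon gives equality.\<close>

lemma ex_stationary_law:
  "\<exists>\<sigma>. is_strategy M \<sigma> \<and> stationary M \<sigma> \<and> (\<forall>s n. hit_within M \<sigma> [] s n = law s n)"
proof -
  have "\<forall>s. \<exists>a. a \<in> act M s \<and> (s \<noteq> target M \<longrightarrow> (\<forall>n. law s (Suc n) = action_law s a n))"
    using ex_conserving_action mdp unfolding is_mdp_def by (metis ex_in_conv)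
  then obtain f where f: "\<And>s. f s \<in> act M s"
      "\<And>s n. s \<noteq> target M \<Longrightarrow> law s (Suc n) = action_law s (f s) n"
    by metis
  define \<sigma> :: "('s, 'a) strategy" where "\<sigma> h = return_pmf (f (snd h))" for h
  \<comment> \<open>The past \<open>hs\<close> is kept arbitrary because the recursion lengthens it;
    \<open>\<sigma>\<close> ignores it.\<close>
  have "hit_within M \<sigma> hs s n = law s n" for hs s n
  proof (induction n arbitrary: hs s)
    case 0
    then show ?case by (simp add: law_def)
  next
    case (Suc n)
    show ?case
    proof (cases "s = target M")
      case False
      have "hit_within M \<sigma> hs s (Suc n) =
          (\<Sum>a\<in>UNIV. pmf (return_pmf (f s)) a * action_law s a n)"
        using False by (simp add: Suc action_law_def \<sigma>_def)
      also have "\<dots> = action_law s (f s) n"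
        by (simp add: indicator_def if_distrib[of "\<lambda>x. x * _"] cong: if_cong)
      finally show ?thesis
        using f(2)[OF False] by simp
    qed (simp add: law_def)
  qed
  moreover have "is_strategy M \<sigma>" "stationary M \<sigma>"
    using f(1) by (auto simp: is_strategy_def stationary_def \<sigma>_def)
  ultimately show ?thesis by blast
qed

text \<open>A strategy weakly overtaking \<open>\<sigma>\<close> is eventually at least
  \<open>law s\<close>, so by \<open>eq_law\<close> it has that very law and is never strictly
  ahead.\<close>

lemma law_strongly_overtaking_optimal:
  assumes "s \<noteq> target M" "\<And>n. hit_within M \<sigma> [] s n = law s n"
  shows "strongly_overtaking_optimal M s \<sigma>"
  unfolding strongly_overtaking_optimal_def
proof clarify
  fix \<tau> assume \<tau>: "is_strategy M \<tau>" "weakly_overtakes M s \<tau> \<sigma>"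
  then have "\<forall>\<^sub>F n in sequentially. hit_within M \<sigma> [] s n \<le> hit_within M \<tau> [] s n"
    unfolding eventually_reach_prob_iff[symmetric] by (auto simp: weakly_overtakes_def)
  then have "hit_within M \<tau> [] s n = hit_within M \<sigma> [] s n" for n
    using eq_law[OF assms(1) \<tau>(1)] by (simp add: assms(2))
  then have "same_hitting_law M s \<tau> \<sigma>"
    by (simp add: same_hitting_law_iff)
  with \<tau>(2) show False
    by (simp add: weakly_overtakes_def same_hitting_law_def)
qed

end

theorem theorem9:
  fixes M :: "('s::finite, 'a::finite) mdp"
  assumes "is_mdp M"
    and "\<forall>s. s \<noteq> target M \<longrightarrow>
           (\<exists>\<sigma>. is_strategy M \<sigma> \<and>
              (\<forall>\<sigma>'. is_strategy M \<sigma>' \<and> \<not> same_hitting_law M s \<sigma> \<sigma>' \<longrightarrow> weakly_overtakes M s \<sigma> \<sigma>'))"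
  shows "\<exists>\<sigma>. is_strategy M \<sigma> \<and> stationary M \<sigma> \<and>
           (\<forall>s. s \<noteq> target M \<longrightarrow> strongly_overtaking_optimal M s \<sigma>)"
proof -
  obtain S where "\<forall>s. s \<noteq> target M \<longrightarrow> is_strategy M (S s) \<and>
      (\<forall>\<sigma>'. is_strategy M \<sigma>' \<and> \<not> same_hitting_law M s (S s) \<sigma>' \<longrightarrow> weakly_overtakes M s (S s) \<sigma>')"
    using assms(2) by metis
  then interpret dominated_mdp M S
    using assms(1) by unfold_locales auto
  show ?thesis
    using ex_stationary_law law_strongly_overtaking_optimal by blast
qed

end
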